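(* Let $A$ be a commutative ring with unity, let $R$ be a commutative $A$-algebra with unity, let $M$ be an $R$-module, and let $\Gamma$ be a commutative cancellative monoid of finite type with Grothendieck group $G(\Gamma)$. Let $D\in\operatorname{Der}_A(R,M)$ be an $A$-derivation and let $\bar\delta:(G(\Gamma),\cdot)\to(M,+)$ be a morphism of groups. Then $$\overline D:\mathcal F^f(G(\Gamma),R)\to\mathcal F^f(G(\Gamma),M),\quad \overline D(\alpha)(q):=D(\alpha(q))+\alpha(q)\bar\delta(q)\ \text{ for all } q\in G(\Gamma),$$ is an $A$-derivation.
   Context: A monoid $(\Gamma,\cdot,1)$ is of finite type if for each $n\in\Gamma$ the set $\{(a,b)\in\Gamma\times\Gamma : n=ab\}$ is finite, and cancellative if $xy=xz$ implies $y=z$. The Grothendieck group $G(\Gamma)$ is the abelian group of fractions $\frac mn$ ($m,n\in\Gamma$), i.e. $\Gamma\times\Gamma$ modulo $(m,n)\sim(p,q)\Leftrightarrow mq=np$, with $\frac mn\cdot\frac{m'}{n'}=\frac{mm'}{nn'}$; $\Gamma$ is viewed as a subset of $G(\Gamma)$ via $n\mapsto\frac n1$. For $N=R$ or $N=M$, $\mathcal F^f(G(\Gamma),N)$ is the set of functions $f:G(\Gamma)\to N$ for which there is $d\in\Gamma$ such that $f(q)\ne0\Rightarrow dq\in\Gamma$ for all $q\in G(\Gamma)$. $\mathcal F^f(G(\Gamma),R)$ is a commutative $R$-algebra (hence $A$-algebra) with unity under pointwise addition and scalar multiplication and $(\alpha\cdot\beta)(q)=\sum_{q'q''=q}\alpha(q')\beta(q'')$;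 $\mathcal F^f(G(\Gamma),M)$ is a module over it under pointwise addition and $(\alpha\cdot f)(q)=\sum_{q'q''=q}\alpha(q')f(q'')$. These sums range over pairs $(q',q'')\in G(\Gamma)^2$ and have only finitely many nonzero terms. For an $A$-algebra $S$ and an $S$-module $N$, an $A$-derivation $D:S\to N$ is an $A$-linear map with $D(fg)=fD(g)+gD(f)$ for all $f,g\in S$; $\operatorname{Der}_A(S,N)$ is the set of these. *)

theory Defs
  imports "HOL-Algebra.Divisibility" "HOL-Algebra.Module"
begin

section \<open>Monoids of finite type and their Grothendieck group\<close>

definition finite_type_monoid :: "('g, 'x) monoid_scheme \<Rightarrow> bool" where
  "finite_type_monoid \<Gamma> \<longleftrightarrow>
     (\<forall>n\<in>carrier \<Gamma>. finite {(a, b) \<in> carrier \<Gamma> \<times> carrier \<Gamma>. n = a \<otimes>\<^bsub>\<Gamma>\<^esub> b})"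

definition groth_rel :: "('g, 'x) monoid_scheme \<Rightarrow> (('g \<times> 'g) \<times> ('g \<times> 'g)) set" where
  "groth_rel \<Gamma> = {((m, n), (p, q)).
     m \<in> carrier \<Gamma> \<and> n \<in> carrier \<Gamma> \<and> p \<in> carrier \<Gamma> \<and> q \<in> carrier \<Gamma> \<and>
     m \<otimes>\<^bsub>\<Gamma>\<^esub> q = n \<otimes>\<^bsub>\<Gamma>\<^esub> p}"

definition groth_frac :: "('g, 'x) monoid_scheme \<Rightarrow> 'g \<Rightarrow> 'g \<Rightarrow> ('g \<times> 'g) set" where
  "groth_frac \<Gamma> m n = groth_rel \<Gamma> `` {(m, n)}"

text \<open>The product of two classes is the union of the (all equal) classes of the products of
  representatives, as usual for quotients; see \<open>groth_frac_mult\<close> below.\<close>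

definition groth_group :: "('g, 'x) monoid_scheme \<Rightarrow> ('g \<times> 'g) set monoid" where
  "groth_group \<Gamma> =
     \<lparr>carrier = (carrier \<Gamma> \<times> carrier \<Gamma>) // groth_rel \<Gamma>,
      monoid.mult = (\<lambda>U V. \<Union>(m, n)\<in>U. \<Union>(m', n')\<in>V. groth_frac \<Gamma> (m \<otimes>\<^bsub>\<Gamma>\<^esub> m') (n \<otimes>\<^bsub>\<Gamma>\<^esub> n')),
      one = groth_frac \<Gamma> \<one>\<^bsub>\<Gamma>\<^esub> \<one>\<^bsub>\<Gamma>\<^esub>\<rparr>"

definition groth_emb :: "('g, 'x) monoid_scheme \<Rightarrow> 'g \<Rightarrow> ('g \<times> 'g) set" where
  "groth_emb \<Gamma> n = groth_frac \<Gamma> n \<one>\<^bsub>\<Gamma>\<^esub>"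


section \<open>The algebra and the module of functions with a common denominator\<close>

text \<open>Functions on \<open>G(\<Gamma>)\<close> are represented by functions that are
  \<^const>\<open>undefined\<close> outside the carrier.\<close>

definition fin_denom_funs ::
  "('g, 'x) monoid_scheme \<Rightarrow> ('n, 'y) ring_scheme \<Rightarrow> (('g \<times> 'g) set \<Rightarrow> 'n) set" where
  "fin_denom_funs \<Gamma> N =
     {f \<in> carrier (groth_group \<Gamma>) \<rightarrow>\<^sub>E carrier N.
        \<exists>d\<in>carrier \<Gamma>. \<forall>q\<in>carrier (groth_group \<Gamma>).
          f q \<noteq> \<zero>\<^bsub>N\<^esub> \<longrightarrow> groth_emb \<Gamma> d \<otimes>\<^bsub>groth_group \<Gamma>\<^esub> q \<in> groth_emb \<Gamma> ` carrier \<Gamma>}"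

text \<open>The convolution with respect to a product \<open>op\<close> with values in \<open>N\<close>. The operation
  \<^const>\<open>finsum\<close> is only meaningful on finite index sets, so the sum is restricted to the pairs
  contributing a nonzero term; there are only finitely many of them
  (\<open>finite_conv_support\<close> below).\<close>

definition conv ::
  "('g, 'x) monoid_scheme \<Rightarrow> ('n, 'y) ring_scheme \<Rightarrow> ('r \<Rightarrow> 'k \<Rightarrow> 'n) \<Rightarrow>
     (('g \<times> 'g) set \<Rightarrow> 'r) \<Rightarrow> (('g \<times> 'g) set \<Rightarrow> 'k) \<Rightarrow> ('g \<times> 'g) set \<Rightarrow> 'n" where
  "conv \<Gamma> N op \<alpha> f = (\<lambda>q\<in>carrier (groth_group \<Gamma>).
     finsum N (\<lambda>(q', q''). op (\<alpha> q') (f q''))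
       {(q', q'') \<in> carrier (groth_group \<Gamma>) \<times> carrier (groth_group \<Gamma>).
          q' \<otimes>\<^bsub>groth_group \<Gamma>\<^esub> q'' = q \<and> op (\<alpha> q') (f q'') \<noteq> \<zero>\<^bsub>N\<^esub>})"

definition fin_denom_algebra ::
  "('g, 'x) monoid_scheme \<Rightarrow> ('a, 'r, 'y) module_scheme \<Rightarrow> ('a, ('g \<times> 'g) set \<Rightarrow> 'r) module" where
  "fin_denom_algebra \<Gamma> R =
     \<lparr>carrier = fin_denom_funs \<Gamma> R,
      monoid.mult = conv \<Gamma> R (\<lambda>x y. x \<otimes>\<^bsub>R\<^esub> y),
      one = (\<lambda>q\<in>carrier (groth_group \<Gamma>). if q = \<one>\<^bsub>groth_group \<Gamma>\<^esub> then \<one>\<^bsub>R\<^esub> else \<zero>\<^bsub>R\<^esub>),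
      zero = (\<lambda>q\<in>carrier (groth_group \<Gamma>). \<zero>\<^bsub>R\<^esub>),
      add = (\<lambda>\<alpha> \<beta>. \<lambda>q\<in>carrier (groth_group \<Gamma>). \<alpha> q \<oplus>\<^bsub>R\<^esub> \<beta> q),
      smult = (\<lambda>a \<alpha>. \<lambda>q\<in>carrier (groth_group \<Gamma>). a \<odot>\<^bsub>R\<^esub> \<alpha> q)\<rparr>"

text \<open>The record type of modules extends that of rings, but the fields \<^const>\<open>monoid.mult\<close> and
  \<^const>\<open>monoid.one\<close> play no role for a module.\<close>

definition fin_denom_module ::
  "('g, 'x) monoid_scheme \<Rightarrow> ('r, 'm, 'y) module_scheme \<Rightarrow>
     (('g \<times> 'g) set \<Rightarrow> 'r, ('g \<times> 'g) set \<Rightarrow> 'm) module" where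
  "fin_denom_module \<Gamma> M =
     \<lparr>carrier = fin_denom_funs \<Gamma> M,
      monoid.mult = undefined,
      one = undefined,
      zero = (\<lambda>q\<in>carrier (groth_group \<Gamma>). \<zero>\<^bsub>M\<^esub>),
      add = (\<lambda>f g. \<lambda>q\<in>carrier (groth_group \<Gamma>). f q \<oplus>\<^bsub>M\<^esub> g q),
      smult = conv \<Gamma> M (\<lambda>x y. x \<odot>\<^bsub>M\<^esub> y)\<rparr>"


section \<open>Derivations\<close>

text \<open>For an \<open>A\<close>-algebra \<open>S\<close> and an \<open>S\<close>-module \<open>N\<close>, the ring \<open>A\<close> acts on \<open>N\<close> through its image
  \<open>a \<cdot> 1\<close> in \<open>S\<close>.\<close>

definition Der ::
  "('a, 'z) ring_scheme \<Rightarrow> ('a, 's, 'x) module_scheme \<Rightarrow> ('s, 'n, 'y) module_scheme \<Rightarrow>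
     ('s \<Rightarrow> 'n) set" where
  "Der A S N =
     {D \<in> carrier S \<rightarrow> carrier N.
        (\<forall>f\<in>carrier S. \<forall>g\<in>carrier S. D (f \<oplus>\<^bsub>S\<^esub> g) = D f \<oplus>\<^bsub>N\<^esub> D g) \<and>
        (\<forall>a\<in>carrier A. \<forall>f\<in>carrier S. D (a \<odot>\<^bsub>S\<^esub> f) = (a \<odot>\<^bsub>S\<^esub> \<one>\<^bsub>S\<^esub>) \<odot>\<^bsub>N\<^esub> D f) \<and>
        (\<forall>f\<in>carrier S. \<forall>g\<in>carrier S. D (f \<otimes>\<^bsub>S\<^esub> g) = f \<odot>\<^bsub>N\<^esub> D g \<oplus>\<^bsub>N\<^esub> g \<odot>\<^bsub>N\<^esub> D f)}"


section \<open>Well-definedness\<close>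

context comm_monoid_cancel
begin

lemma groth_equiv: "equiv (carrier G \<times> carrier G) (groth_rel G)"
proof (rule equivI)
  show "groth_rel G \<subseteq> (carrier G \<times> carrier G) \<times> carrier G \<times> carrier G"
    by (auto simp: groth_rel_def)
  show "refl_on (carrier G \<times> carrier G) (groth_rel G)"
    by (auto simp: groth_rel_def refl_on_def m_comm)
  show "sym (groth_rel G)"
    unfolding sym_def groth_rel_def by clarsimp (metis m_comm)
  show "trans (groth_rel G)"
  proof (rule transI, clarsimp simp: groth_rel_def)
    fix a b c d e f
    assume c: "a \<in> carrier G" "b \<in> carrier G" "c \<in> carrier G" "d \<in> carrier G"
      "e \<in> carrier G" "f \<in> carrier G"
      and 1: "a \<otimes> d = b \<otimes> c" and 2: "c \<otimes> f = d \<otimes> e"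
    have "d \<otimes> (a \<otimes> f) = (a \<otimes> d) \<otimes> f" using c by (simp add: m_ac)
    also have "\<dots> = b \<otimes> (c \<otimes> f)" using 1 c by (simp add: m_ac)
    also have "\<dots> = d \<otimes> (b \<otimes> e)" using 2 c by (simp add: m_ac)
    finally show "a \<otimes> f = b \<otimes> e" using c by (metis l_cancel m_closed)
  qed
qed

lemma groth_frac_eq_iff:
  assumes "m \<in> carrier G" "n \<in> carrier G" "p \<in> carrier G" "q \<in> carrier G"
  shows "groth_frac G m n = groth_frac G p q \<longleftrightarrow> m \<otimes> q = n \<otimes> p"
  using eq_equiv_class_iff[OF groth_equiv, of "(m, n)" "(p, q)"] assms
  by (simp add: groth_frac_def groth_rel_def)

lemma groth_carrier:
  "carrier (groth_group G) = {groth_frac G m n | m n. m \<in> carrier G \<and> n \<in> carrier G}"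
  by (auto simp: groth_group_def groth_frac_def quotient_def)

lemma groth_frac_mult:
  assumes "m \<in> carrier G" "n \<in> carrier G" "p \<in> carrier G" "q \<in> carrier G"
  shows "groth_frac G m n \<otimes>\<^bsub>groth_group G\<^esub> groth_frac G p q = groth_frac G (m \<otimes> p) (n \<otimes> q)"
proof -
  have eq: "groth_frac G (a \<otimes> c) (b \<otimes> d) = groth_frac G (m \<otimes> p) (n \<otimes> q)"
    if "(a, b) \<in> groth_frac G m n" "(c, d) \<in> groth_frac G p q" for a b c d
  proof -
    have c: "a \<in> carrier G" "b \<in> carrier G" "c \<in> carrier G" "d \<in> carrier G"
      and e: "m \<otimes> b = n \<otimes> a" "p \<otimes> d = q \<otimes> c"
      using that by (auto simp: groth_frac_def groth_rel_def)
    have "(m \<otimes> p) \<otimes> (b \<otimes> d) = (m \<otimes> b) \<otimes> (p \<otimes> d)" using c assms by (simp add: m_ac)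
    also have "\<dots> = (n \<otimes> q) \<otimes> (a \<otimes> c)" unfolding e using c assms by (simp add: m_ac)
    finally have "(m \<otimes> p) \<otimes> (b \<otimes> d) = (n \<otimes> q) \<otimes> (a \<otimes> c)" .
    then have "groth_frac G (m \<otimes> p) (n \<otimes> q) = groth_frac G (a \<otimes> c) (b \<otimes> d)"
      using c assms by (subst groth_frac_eq_iff) auto
    then show ?thesis by simp
  qed
  have "(m, n) \<in> groth_frac G m n" "(p, q) \<in> groth_frac G p q"
    using assms by (auto simp: groth_frac_def groth_rel_def m_comm)
  then have "(\<Union>(a, b)\<in>groth_frac G m n. \<Union>(c, d)\<in>groth_frac G p q.
      groth_frac G (a \<otimes> c) (b \<otimes> d)) = groth_frac G (m \<otimes> p) (n \<otimes> q)"
    using eq by fast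
  then show ?thesis by (simp add: groth_group_def)
qed

lemma groth_comm_group: "comm_group (groth_group G)"
proof (rule comm_groupI)
  have one: "\<one>\<^bsub>groth_group G\<^esub> = groth_frac G \<one> \<one>" by (simp add: groth_group_def)
  show "\<one>\<^bsub>groth_group G\<^esub> \<in> carrier (groth_group G)"
    unfolding one groth_carrier by blast
  show "x \<otimes>\<^bsub>groth_group G\<^esub> y \<in> carrier (groth_group G)"
    if "x \<in> carrier (groth_group G)" "y \<in> carrier (groth_group G)" for x y
    using that unfolding groth_carrier by (auto simp: groth_frac_mult) (metis m_closed)
  show "x \<otimes>\<^bsub>groth_group G\<^esub> y \<otimes>\<^bsub>groth_group G\<^esub> z = x \<otimes>\<^bsub>groth_group G\<^esub> (y \<otimes>\<^bsub>groth_group G\<^esub> z)"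
    if "x \<in> carrier (groth_group G)" "y \<in> carrier (groth_group G)"
      "z \<in> carrier (groth_group G)" for x y z
    using that unfolding groth_carrier by (auto simp: groth_frac_mult m_assoc)
  show "x \<otimes>\<^bsub>groth_group G\<^esub> y = y \<otimes>\<^bsub>groth_group G\<^esub> x"
    if "x \<in> carrier (groth_group G)" "y \<in> carrier (groth_group G)" for x y
    using that unfolding groth_carrier by (auto simp: groth_frac_mult m_comm)
  show "\<one>\<^bsub>groth_group G\<^esub> \<otimes>\<^bsub>groth_group G\<^esub> x = x" if "x \<in> carrier (groth_group G)" for x
    using that unfolding groth_carrier one by (auto simp: groth_frac_mult)
  show "\<exists>y\<in>carrier (groth_group G). y \<otimes>\<^bsub>groth_group G\<^esub> x = \<one>\<^bsub>groth_group G\<^esub>"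
    if x: "x \<in> carrier (groth_group G)" for x
  proof -
    obtain m n where mn: "x = groth_frac G m n" "m \<in> carrier G" "n \<in> carrier G"
      using x unfolding groth_carrier by blast
    have "groth_frac G n m \<otimes>\<^bsub>groth_group G\<^esub> x = \<one>\<^bsub>groth_group G\<^esub>"
      using mn by (simp add: one groth_frac_mult groth_frac_eq_iff m_comm)
    then show ?thesis using mn unfolding groth_carrier by blast
  qed
qed

lemma groth_emb_inj: "inj_on (groth_emb G) (carrier G)"
  by (auto simp: inj_on_def groth_emb_def groth_frac_eq_iff)

lemma groth_emb_mult:
  "\<lbrakk>m \<in> carrier G; n \<in> carrier G\<rbrakk> \<Longrightarrow>
     groth_emb G m \<otimes>\<^bsub>groth_group G\<^esub> groth_emb G n = groth_emb G (m \<otimes> n)"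
  by (simp add: groth_emb_def groth_frac_mult)

lemma finite_denom_pairs:
  assumes "finite_type_monoid G" "d \<in> carrier G" "e \<in> carrier G" "q \<in> carrier (groth_group G)"
  shows "finite {(q', q'') \<in> carrier (groth_group G) \<times> carrier (groth_group G).
     q' \<otimes>\<^bsub>groth_group G\<^esub> q'' = q \<and>
     groth_emb G d \<otimes>\<^bsub>groth_group G\<^esub> q' \<in> groth_emb G ` carrier G \<and>
     groth_emb G e \<otimes>\<^bsub>groth_group G\<^esub> q'' \<in> groth_emb G ` carrier G}" (is "finite ?P")
proof -
  interpret Q: comm_group "groth_group G" by (rule groth_comm_group)
  let ?d = "groth_emb G d" and ?e = "groth_emb G e"
  have embc: "groth_emb G n \<in> carrier (groth_group G)" if "n \<in> carrier G" for n
    using that unfolding groth_emb_def groth_carrier by blast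
  let ?h = "\<lambda>(q', q''). (?d \<otimes>\<^bsub>groth_group G\<^esub> q', ?e \<otimes>\<^bsub>groth_group G\<^esub> q'')"
  have inj: "inj_on ?h ?P"
    by (rule inj_onI) (clarsimp, metis assms(2,3) embc Q.l_cancel)
  show ?thesis
  proof (cases "?P = {}")
    case True
    then show ?thesis by (simp only: finite.emptyI)
  next
    case False
    have key: "\<exists>a\<in>carrier G. \<exists>b\<in>carrier G. ?h p = (groth_emb G a, groth_emb G b) \<and>
        groth_emb G (a \<otimes> b) = ?d \<otimes>\<^bsub>groth_group G\<^esub> ?e \<otimes>\<^bsub>groth_group G\<^esub> q" if "p \<in> ?P" for p
    proof -
      obtain q1 q2 where p: "p = (q1, q2)" by (cases p)
      have q: "q1 \<in> carrier (groth_group G)" "q2 \<in> carrier (groth_group G)"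
        "q1 \<otimes>\<^bsub>groth_group G\<^esub> q2 = q"
        and im: "?d \<otimes>\<^bsub>groth_group G\<^esub> q1 \<in> groth_emb G ` carrier G"
        "?e \<otimes>\<^bsub>groth_group G\<^esub> q2 \<in> groth_emb G ` carrier G"
        using that unfolding p by simp_all
      obtain a b where ab: "a \<in> carrier G" "?d \<otimes>\<^bsub>groth_group G\<^esub> q1 = groth_emb G a"
        "b \<in> carrier G" "?e \<otimes>\<^bsub>groth_group G\<^esub> q2 = groth_emb G b"
        using im by (elim imageE)
      have "groth_emb G (a \<otimes> b) = (?d \<otimes>\<^bsub>groth_group G\<^esub> q1) \<otimes>\<^bsub>groth_group G\<^esub> (?e \<otimes>\<^bsub>groth_group G\<^esub> q2)"
        using ab by (simp add: groth_emb_mult)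
      also have "\<dots> = ?d \<otimes>\<^bsub>groth_group G\<^esub> ?e \<otimes>\<^bsub>groth_group G\<^esub> q"
        using q(1,2) q(3)[symmetric] embc assms(2,3) by (simp add: Q.m_ac)
      finally show ?thesis using p ab by auto
    qed
    obtain p0 where p0: "p0 \<in> ?P" using False by blast
    obtain n where n: "n \<in> carrier G"
      "groth_emb G n = ?d \<otimes>\<^bsub>groth_group G\<^esub> ?e \<otimes>\<^bsub>groth_group G\<^esub> q"
      using key[OF p0] by (elim bexE conjE) (rule that[OF m_closed])
    have "?h ` ?P \<subseteq> (\<lambda>(a, b). (groth_emb G a, groth_emb G b)) `
        {(a, b) \<in> carrier G \<times> carrier G. n = a \<otimes> b}"
    proof
      fix x assume "x \<in> ?h ` ?P"
      then obtain p where p: "x = ?h p" "p \<in> ?P" by (rule imageE)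
      have "\<exists>a\<in>carrier G. \<exists>b\<in>carrier G. x = (groth_emb G a, groth_emb G b) \<and>
          groth_emb G (a \<otimes> b) = groth_emb G n"
        using key[OF p(2)] unfolding p(1) n(2) .
      then obtain a b where ab: "a \<in> carrier G" "b \<in> carrier G"
        "x = (groth_emb G a, groth_emb G b)" "groth_emb G (a \<otimes> b) = groth_emb G n"
        by blast
      then have "n = a \<otimes> b"
        using n(1) inj_onD[OF groth_emb_inj, of "a \<otimes> b" n] by auto
      with ab show "x \<in> (\<lambda>(a, b). (groth_emb G a, groth_emb G b)) `
        {(a, b) \<in> carrier G \<times> carrier G. n = a \<otimes> b}" by auto
    qed
    then have "finite (?h ` ?P)"
      by (rule finite_subset)
        (rule finite_imageI[OF assms(1)[unfolded finite_type_monoid_def, rule_format, OF n(1)]])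
    then show ?thesis using inj by (rule finite_imageD)
  qed
qed

lemma finite_conv_support:
  assumes "finite_type_monoid G" "\<alpha> \<in> fin_denom_funs G R" "f \<in> fin_denom_funs G K"
    and "\<And>y. y \<in> carrier K \<Longrightarrow> op \<zero>\<^bsub>R\<^esub> y = \<zero>\<^bsub>N\<^esub>" "\<And>x. x \<in> carrier R \<Longrightarrow> op x \<zero>\<^bsub>K\<^esub> = \<zero>\<^bsub>N\<^esub>"
    and "q \<in> carrier (groth_group G)"
  shows "finite {(q', q'') \<in> carrier (groth_group G) \<times> carrier (groth_group G).
     q' \<otimes>\<^bsub>groth_group G\<^esub> q'' = q \<and> op (\<alpha> q') (f q'') \<noteq> \<zero>\<^bsub>N\<^esub>}" (is "finite ?S")
proof -
  obtain d where d: "d \<in> carrier G" "\<And>q. q \<in> carrier (groth_group G) \<Longrightarrow> \<alpha> q \<noteq> \<zero>\<^bsub>R\<^esub> \<Longrightarrow>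
      groth_emb G d \<otimes>\<^bsub>groth_group G\<^esub> q \<in> groth_emb G ` carrier G"
    using assms(2) by (auto simp: fin_denom_funs_def)
  obtain e where e: "e \<in> carrier G" "\<And>q. q \<in> carrier (groth_group G) \<Longrightarrow> f q \<noteq> \<zero>\<^bsub>K\<^esub> \<Longrightarrow>
      groth_emb G e \<otimes>\<^bsub>groth_group G\<^esub> q \<in> groth_emb G ` carrier G"
    using assms(3) by (auto simp: fin_denom_funs_def)
  have val: "\<alpha> q \<in> carrier R" "f q \<in> carrier K" if "q \<in> carrier (groth_group G)" for q
    using assms(2,3) that by (auto simp: fin_denom_funs_def)
  have nz: "\<alpha> q' \<noteq> \<zero>\<^bsub>R\<^esub>" "f q'' \<noteq> \<zero>\<^bsub>K\<^esub>"
    if "q' \<in> carrier (groth_group G)" "q'' \<in> carrier (groth_group G)"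
      "op (\<alpha> q') (f q'') \<noteq> \<zero>\<^bsub>N\<^esub>" for q' q''
    using that val assms(4,5) by metis+
  have "?S \<subseteq> {(q', q'') \<in> carrier (groth_group G) \<times> carrier (groth_group G).
     q' \<otimes>\<^bsub>groth_group G\<^esub> q'' = q \<and>
     groth_emb G d \<otimes>\<^bsub>groth_group G\<^esub> q' \<in> groth_emb G ` carrier G \<and>
     groth_emb G e \<otimes>\<^bsub>groth_group G\<^esub> q'' \<in> groth_emb G ` carrier G}"
    by (rule subsetI) (clarsimp simp: d(2) e(2) nz)
  then show ?thesis
    by (rule finite_subset) (rule finite_denom_pairs[OF assms(1) d(1) e(1) assms(6)])
qed

end

end

theory Submission
  imports Defs
begin

text \<open>
  For a fixed \<open>q \<in> G(\<Gamma>)\<close>, the value at \<open>q\<close> of the derived function is \<open>\<phi>\<^sub>q(\<alpha>(q))\<close>, where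
  \<open>\<phi>\<^sub>q(r) = D(r) + r \<cdot> \<delta>(q)\<close> is an additive map \<open>R \<rightarrow> M\<close> (\<open>twist_add\<close>). Since \<open>D\<close> satisfies the
  Leibniz rule and \<open>\<delta>(q'q'') = \<delta>(q') + \<delta>(q'')\<close>, these maps satisfy a twisted Leibniz rule
  (\<open>twist_mult\<close>):
  \<open>\<phi>\<^bsub>q'q''\<^esub>(r s) = r \<cdot> \<phi>\<^bsub>q''\<^esub>(s) + s \<cdot> \<phi>\<^bsub>q'\<^esub>(r)\<close>.
  Summing it over all factorizations \<open>q = q'q''\<close> with \<open>r = \<alpha>(q')\<close> and \<open>s = \<beta>(q'')\<close> gives the Leibniz
  rule for convolutions.

  Each of the convolutions that occur ranges over its own support, so the sums are first brought to
  a common finite index set. If \<open>d\<close> and \<open>e\<close> are denominators of \<open>\<alpha>\<close> and \<open>\<beta>\<close>, then this set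
  consists of the factorizations \<open>q = q'q''\<close> with \<open>dq' \<in> \<Gamma>\<close> and \<open>eq'' \<in> \<Gamma>\<close>
  (\<open>conv_eq_finsum_denom_pairs\<close>). It serves for the derived functions too, because
  \<open>\<phi>\<^sub>q(0) = 0\<close> implies that they inherit the denominators of \<open>\<alpha>\<close> and \<open>\<beta>\<close>.
\<close>

section \<open>Additive maps and finite sums\<close>

lemma additive_zero:
  assumes "abelian_group M" "abelian_group N" "h \<in> carrier M \<rightarrow> carrier N"
    and "\<And>x y. x \<in> carrier M \<Longrightarrow> y \<in> carrier M \<Longrightarrow> h (x \<oplus>\<^bsub>M\<^esub> y) = h x \<oplus>\<^bsub>N\<^esub> h y"
  shows "h \<zero>\<^bsub>M\<^esub> = \<zero>\<^bsub>N\<^esub>"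
proof -
  interpret M: abelian_group M by fact
  interpret N: abelian_group N by fact
  have c: "h \<zero>\<^bsub>M\<^esub> \<in> carrier N" using assms(3) by auto
  have "h \<zero>\<^bsub>M\<^esub> = h \<zero>\<^bsub>M\<^esub> \<oplus>\<^bsub>N\<^esub> h \<zero>\<^bsub>M\<^esub>"
    using assms(4)[of "\<zero>\<^bsub>M\<^esub>" "\<zero>\<^bsub>M\<^esub>"] by simp
  with c show ?thesis by (metis N.add.r_cancel_one')
qed

lemma additive_finsum:
  assumes "abelian_group M" "abelian_group N" "h \<in> carrier M \<rightarrow> carrier N"
    and add: "\<And>x y. x \<in> carrier M \<Longrightarrow> y \<in> carrier M \<Longrightarrow> h (x \<oplus>\<^bsub>M\<^esub> y) = h x \<oplus>\<^bsub>N\<^esub> h y"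
    and "finite I" "f \<in> I \<rightarrow> carrier M"
  shows "h (finsum M f I) = finsum N (\<lambda>i. h (f i)) I"
  using assms(5,6)
proof (induction rule: finite_induct)
  interpret M: abelian_group M by fact
  interpret N: abelian_group N by fact
  {
    case empty
    show ?case using additive_zero[OF assms(1-4)] by simp
  next
    case (insert x F)
    have "h (finsum M f (insert x F)) = h (f x \<oplus>\<^bsub>M\<^esub> finsum M f F)"
      using insert by (subst M.finsum_insert) auto
    also have "\<dots> = h (f x) \<oplus>\<^bsub>N\<^esub> h (finsum M f F)"
      using insert by (intro add M.finsum_closed) auto
    also have "h (finsum M f F) = finsum N (\<lambda>i. h (f i)) F"
      using insert by auto
    also have "h (f x) \<oplus>\<^bsub>N\<^esub> \<dots> = finsum N (\<lambda>i. h (f i)) (insert x F)"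
      using insert assms(3) by (subst N.finsum_insert) auto
    finally show ?case .
  }
qed


section \<open>Denominators and convolutions\<close>

text \<open>The element \<open>d\<close> is a denominator of the function \<open>f\<close> on \<open>G(\<Gamma>)\<close>: if \<open>f(q) \<noteq> 0\<close> then
  \<open>dq \<in> \<Gamma>\<close>.\<close>

definition has_denom ::
  "('g, 'x) monoid_scheme \<Rightarrow> ('n, 'y) ring_scheme \<Rightarrow> 'g \<Rightarrow> (('g \<times> 'g) set \<Rightarrow> 'n) \<Rightarrow> bool" where
  "has_denom \<Gamma> N d f \<longleftrightarrow> d \<in> carrier \<Gamma> \<and> f \<in> carrier (groth_group \<Gamma>) \<rightarrow>\<^sub>E carrier N \<and>
     (\<forall>q\<in>carrier (groth_group \<Gamma>). f q \<noteq> \<zero>\<^bsub>N\<^esub> \<longrightarrow>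
        groth_emb \<Gamma> d \<otimes>\<^bsub>groth_group \<Gamma>\<^esub> q \<in> groth_emb \<Gamma> ` carrier \<Gamma>)"

text \<open>The factorizations \<open>q = q'q''\<close> in \<open>G(\<Gamma>)\<close> with \<open>dq' \<in> \<Gamma>\<close> and \<open>eq'' \<in> \<Gamma>\<close>.\<close>

definition denom_pairs ::
  "('g, 'x) monoid_scheme \<Rightarrow> 'g \<Rightarrow> 'g \<Rightarrow> ('g \<times> 'g) set \<Rightarrow> (('g \<times> 'g) set \<times> ('g \<times> 'g) set) set" where
  "denom_pairs \<Gamma> d e q =
     {(q', q'') \<in> carrier (groth_group \<Gamma>) \<times> carrier (groth_group \<Gamma>).
        q' \<otimes>\<^bsub>groth_group \<Gamma>\<^esub> q'' = q \<and>
        groth_emb \<Gamma> d \<otimes>\<^bsub>groth_group \<Gamma>\<^esub> q' \<in> groth_emb \<Gamma> ` carrier \<Gamma> \<and>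
        groth_emb \<Gamma> e \<otimes>\<^bsub>groth_group \<Gamma>\<^esub> q'' \<in> groth_emb \<Gamma> ` carrier \<Gamma>}"

lemma fin_denom_funs_iff: "f \<in> fin_denom_funs \<Gamma> N \<longleftrightarrow> (\<exists>d. has_denom \<Gamma> N d f)"
  by (auto simp: fin_denom_funs_def has_denom_def)

lemma has_denom_closed:
  "\<lbrakk>has_denom \<Gamma> N d f; q \<in> carrier (groth_group \<Gamma>)\<rbrakk> \<Longrightarrow> f q \<in> carrier N"
  by (auto simp: has_denom_def)

lemma has_denomD:
  "\<lbrakk>has_denom \<Gamma> N d f; q \<in> carrier (groth_group \<Gamma>); f q \<noteq> \<zero>\<^bsub>N\<^esub>\<rbrakk> \<Longrightarrow>
     groth_emb \<Gamma> d \<otimes>\<^bsub>groth_group \<Gamma>\<^esub> q \<in> groth_emb \<Gamma> ` carrier \<Gamma>"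
  by (auto simp: has_denom_def)

lemma has_denom_carrier: "has_denom \<Gamma> N d f \<Longrightarrow> d \<in> carrier \<Gamma>"
  by (simp add: has_denom_def)

lemma has_denom_pointwise:
  assumes "has_denom \<Gamma> R d \<alpha>"
    and "\<And>q. q \<in> carrier (groth_group \<Gamma>) \<Longrightarrow> g q \<in> carrier N"
    and "\<And>q. q \<in> carrier (groth_group \<Gamma>) \<Longrightarrow> \<alpha> q = \<zero>\<^bsub>R\<^esub> \<Longrightarrow> g q = \<zero>\<^bsub>N\<^esub>"
  shows "has_denom \<Gamma> N d (\<lambda>q\<in>carrier (groth_group \<Gamma>). g q)"
  using assms by (auto simp: has_denom_def)

context comm_monoid_cancel
begin

lemma groth_emb_closed: "n \<in> carrier G \<Longrightarrow> groth_emb G n \<in> carrier (groth_group G)"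
  unfolding groth_emb_def groth_carrier by blast

lemma has_denom_mult_right:
  assumes "has_denom G N d f" "e \<in> carrier G"
  shows "has_denom G N (d \<otimes> e) f"
proof -
  interpret Q: comm_group "groth_group G" by (rule groth_comm_group)
  have d: "d \<in> carrier G" using assms(1) by (rule has_denom_carrier)
  have "groth_emb G (d \<otimes> e) \<otimes>\<^bsub>groth_group G\<^esub> q \<in> groth_emb G ` carrier G"
    if q: "q \<in> carrier (groth_group G)" "f q \<noteq> \<zero>\<^bsub>N\<^esub>" for q
  proof -
    obtain a where a: "a \<in> carrier G" "groth_emb G d \<otimes>\<^bsub>groth_group G\<^esub> q = groth_emb G a"
      using has_denomD[OF assms(1) q] by (elim imageE)
    have "groth_emb G (d \<otimes> e) \<otimes>\<^bsub>groth_group G\<^esub> q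
        = groth_emb G e \<otimes>\<^bsub>groth_group G\<^esub> (groth_emb G d \<otimes>\<^bsub>groth_group G\<^esub> q)"
      using d assms(2) q groth_emb_closed by (simp add: groth_emb_mult[symmetric] Q.m_ac)
    also have "\<dots> = groth_emb G (e \<otimes> a)"
      using a assms(2) by (simp add: groth_emb_mult)
    finally show ?thesis using a assms(2) by auto
  qed
  then show ?thesis using assms d by (auto simp: has_denom_def)
qed

lemma has_denom_mult_left:
  "\<lbrakk>has_denom G N d f; e \<in> carrier G\<rbrakk> \<Longrightarrow> has_denom G N (e \<otimes> d) f"
  using has_denom_mult_right[of N d f e] has_denom_carrier[of G N d f] by (simp add: m_comm)

lemma finite_denom_pairs':
  "\<lbrakk>finite_type_monoid G; d \<in> carrier G; e \<in> carrier G; q \<in> carrier (groth_group G)\<rbrakk> \<Longrightarrow>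
     finite (denom_pairs G d e q)"
  unfolding denom_pairs_def by (rule finite_denom_pairs)

lemma denom_pairsD:
  assumes "(q', q'') \<in> denom_pairs G d e q"
  shows "q' \<in> carrier (groth_group G)" "q'' \<in> carrier (groth_group G)"
    "q' \<otimes>\<^bsub>groth_group G\<^esub> q'' = q"
  using assms by (simp_all add: denom_pairs_def)

lemma denom_pairs_swap: "denom_pairs G e d q = prod.swap ` denom_pairs G d e q"
proof -
  interpret Q: comm_group "groth_group G" by (rule groth_comm_group)
  have "(b, a) \<in> denom_pairs G d e q" if "(a, b) \<in> denom_pairs G e d q" for a b d e
    using that by (simp add: denom_pairs_def Q.m_comm)
  then show ?thesis by (auto simp: image_iff) force
qed

lemma denom_pairs_denom:
  assumes "d \<in> carrier G" "e \<in> carrier G" "(q', q'') \<in> denom_pairs G d e q"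
  shows "groth_emb G (d \<otimes> e) \<otimes>\<^bsub>groth_group G\<^esub> q \<in> groth_emb G ` carrier G"
proof -
  interpret Q: comm_group "groth_group G" by (rule groth_comm_group)
  note q = denom_pairsD[OF assms(3)]
  obtain a b where ab: "a \<in> carrier G" "groth_emb G d \<otimes>\<^bsub>groth_group G\<^esub> q' = groth_emb G a"
    "b \<in> carrier G" "groth_emb G e \<otimes>\<^bsub>groth_group G\<^esub> q'' = groth_emb G b"
    using assms(3) unfolding denom_pairs_def by blast
  have "groth_emb G (d \<otimes> e) \<otimes>\<^bsub>groth_group G\<^esub> q =
      (groth_emb G d \<otimes>\<^bsub>groth_group G\<^esub> q') \<otimes>\<^bsub>groth_group G\<^esub> (groth_emb G e \<otimes>\<^bsub>groth_group G\<^esub> q'')"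
    using assms(1,2) q(1,2) groth_emb_closed
    by (simp add: groth_emb_mult[symmetric] q(3)[symmetric] Q.m_ac)
  also have "\<dots> = groth_emb G (a \<otimes> b)" using ab by (simp add: groth_emb_mult)
  finally show ?thesis using ab by auto
qed

text \<open>The index set on the right depends only on denominators of the two functions and not on their
  supports, so convolutions of different functions become comparable termwise.\<close>

lemma conv_eq_finsum_denom_pairs:
  assumes "abelian_monoid N" "finite_type_monoid G"
    and \<alpha>: "has_denom G R d \<alpha>" and f: "has_denom G K e f"
    and op: "\<And>x y. x \<in> carrier R \<Longrightarrow> y \<in> carrier K \<Longrightarrow> op x y \<in> carrier N"
      "\<And>y. y \<in> carrier K \<Longrightarrow> op \<zero>\<^bsub>R\<^esub> y = \<zero>\<^bsub>N\<^esub>" "\<And>x. x \<in> carrier R \<Longrightarrow> op x \<zero>\<^bsub>K\<^esub> = \<zero>\<^bsub>N\<^esub>"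
    and q: "q \<in> carrier (groth_group G)"
  shows "conv G N op \<alpha> f q = finsum N (\<lambda>(q', q''). op (\<alpha> q') (f q'')) (denom_pairs G d e q)"
proof -
  interpret N: abelian_monoid N by fact
  have val: "\<alpha> x \<in> carrier R" "f x \<in> carrier K" if "x \<in> carrier (groth_group G)" for x
    using \<alpha> f that by (auto intro: has_denom_closed)
  have nz: "\<alpha> x \<noteq> \<zero>\<^bsub>R\<^esub>" "f y \<noteq> \<zero>\<^bsub>K\<^esub>"
    if "x \<in> carrier (groth_group G)" "y \<in> carrier (groth_group G)" "op (\<alpha> x) (f y) \<noteq> \<zero>\<^bsub>N\<^esub>" for x y
    using that val op(2,3) by metis+
  let ?S = "{(q', q'') \<in> carrier (groth_group G) \<times> carrier (groth_group G).
          q' \<otimes>\<^bsub>groth_group G\<^esub> q'' = q \<and> op (\<alpha> q') (f q'') \<noteq> \<zero>\<^bsub>N\<^esub>}"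
  have sub: "?S \<subseteq> denom_pairs G d e q"
    unfolding denom_pairs_def
    by (rule subsetI) (clarsimp simp: nz has_denomD[OF \<alpha>] has_denomD[OF f])
  have "finsum N (\<lambda>(q', q''). op (\<alpha> q') (f q'')) ?S
      = finsum N (\<lambda>(q', q''). op (\<alpha> q') (f q'')) (denom_pairs G d e q)"
  proof (rule N.add.finprod_mono_neutral_cong_left[OF _ sub])
    show "finite (denom_pairs G d e q)"
      using assms(2) has_denom_carrier[OF \<alpha>] has_denom_carrier[OF f] q by (rule finite_denom_pairs')
    show "(case i of (q', q'') \<Rightarrow> op (\<alpha> q') (f q'')) = \<zero>\<^bsub>N\<^esub>"
      if "i \<in> denom_pairs G d e q - ?S" for i
      using that by (auto simp: denom_pairs_def)
    show "(\<lambda>(q', q''). op (\<alpha> q') (f q'')) \<in> denom_pairs G d e q \<rightarrow> carrier N"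
      by (auto intro!: op(1) val intro: denom_pairsD(1,2))
  qed simp
  then show ?thesis using q by (simp add: conv_def)
qed

lemma has_denom_conv:
  assumes "abelian_monoid N" "finite_type_monoid G"
    and \<alpha>: "has_denom G R d \<alpha>" and f: "has_denom G K e f"
    and op: "\<And>x y. x \<in> carrier R \<Longrightarrow> y \<in> carrier K \<Longrightarrow> op x y \<in> carrier N"
      "\<And>y. y \<in> carrier K \<Longrightarrow> op \<zero>\<^bsub>R\<^esub> y = \<zero>\<^bsub>N\<^esub>" "\<And>x. x \<in> carrier R \<Longrightarrow> op x \<zero>\<^bsub>K\<^esub> = \<zero>\<^bsub>N\<^esub>"
  shows "has_denom G N (d \<otimes> e) (conv G N op \<alpha> f)"
proof -
  interpret N: abelian_monoid N by fact
  have d: "d \<in> carrier G" "e \<in> carrier G" using \<alpha> f by (auto intro: has_denom_carrier)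
  have eq: "conv G N op \<alpha> f q = finsum N (\<lambda>(q', q''). op (\<alpha> q') (f q'')) (denom_pairs G d e q)"
    if "q \<in> carrier (groth_group G)" for q
    using assms that by (rule conv_eq_finsum_denom_pairs)
  have cl: "conv G N op \<alpha> f q \<in> carrier N" if "q \<in> carrier (groth_group G)" for q
    unfolding eq[OF that]
    by (auto intro!: N.finsum_closed op(1) has_denom_closed[OF \<alpha>] has_denom_closed[OF f]
        intro: denom_pairsD(1,2))
  have "groth_emb G (d \<otimes> e) \<otimes>\<^bsub>groth_group G\<^esub> q \<in> groth_emb G ` carrier G"
    if q: "q \<in> carrier (groth_group G)" and nz: "conv G N op \<alpha> f q \<noteq> \<zero>\<^bsub>N\<^esub>" for q
  proof -
    have "denom_pairs G d e q \<noteq> {}" using nz unfolding eq[OF q] by auto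
    then obtain q' q'' where "(q', q'') \<in> denom_pairs G d e q" by auto
    then show ?thesis using denom_pairs_denom d by blast
  qed
  then show ?thesis using d cl by (auto simp: has_denom_def conv_def)
qed

text \<open>A function concentrated at the unit of \<open>G(\<Gamma>)\<close> acts by convolution as a scalar. Thus
  the action of \<open>A\<close> on functions with values in \<open>M\<close>, which is convolution with \<open>a \<cdot> 1\<close>, is
  pointwise.\<close>

lemma conv_at_one:
  assumes "abelian_monoid N" and q: "q \<in> carrier (groth_group G)"
    and K: "\<And>x. x \<in> carrier (groth_group G) \<Longrightarrow> f x \<in> carrier K"
    and op: "op c (f q) \<in> carrier N" "\<And>y. y \<in> carrier K \<Longrightarrow> op z y = \<zero>\<^bsub>N\<^esub>"
    and u: "u \<one>\<^bsub>groth_group G\<^esub> = c"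
      "\<And>x. x \<in> carrier (groth_group G) \<Longrightarrow> x \<noteq> \<one>\<^bsub>groth_group G\<^esub> \<Longrightarrow> u x = z"
  shows "conv G N op u f q = op c (f q)"
proof -
  interpret N: abelian_monoid N by fact
  interpret Q: comm_group "groth_group G" by (rule groth_comm_group)
  let ?S = "{(q', q'') \<in> carrier (groth_group G) \<times> carrier (groth_group G).
          q' \<otimes>\<^bsub>groth_group G\<^esub> q'' = q \<and> op (u q') (f q'') \<noteq> \<zero>\<^bsub>N\<^esub>}"
  have sub: "?S \<subseteq> {(\<one>\<^bsub>groth_group G\<^esub>, q)}"
  proof (rule subsetI, clarify)
    fix a b assume ab: "a \<in> carrier (groth_group G)" "b \<in> carrier (groth_group G)"
      "op (u a) (f b) \<noteq> \<zero>\<^bsub>N\<^esub>" and "q = a \<otimes>\<^bsub>groth_group G\<^esub> b"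
    have "a = \<one>\<^bsub>groth_group G\<^esub>" using ab u(2) op(2) K by metis
    then show "a = \<one>\<^bsub>groth_group G\<^esub> \<and> b = a \<otimes>\<^bsub>groth_group G\<^esub> b" using ab by simp
  qed
  have "finsum N (\<lambda>(q', q''). op (u q') (f q'')) ?S
      = finsum N (\<lambda>(q', q''). op (u q') (f q'')) {(\<one>\<^bsub>groth_group G\<^esub>, q)}"
    by (rule N.add.finprod_mono_neutral_cong_left[OF _ sub]) (use q u op in auto)
  also have "\<dots> = op c (f q)" using op(1) u(1) by (subst N.finsum_insert) auto
  finally show ?thesis using q by (simp add: conv_def)
qed

end


section \<open>The twisted derivations\<close>

text \<open>The map \<open>r \<mapsto> D(r) + r t\<close> for an element \<open>t\<close> of the module; it is \<open>\<phi>\<^sub>q\<close> for \<open>t = \<delta>(q)\<close>.\<close>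

definition twist ::
  "('r, 'm, 'k) module_scheme \<Rightarrow> ('r \<Rightarrow> 'm) \<Rightarrow> 'm \<Rightarrow> 'r \<Rightarrow> 'm" where
  "twist M D t r = D r \<oplus>\<^bsub>M\<^esub> r \<odot>\<^bsub>M\<^esub> t"

lemma DerD:
  assumes "D \<in> Der A S N"
  shows "D \<in> carrier S \<rightarrow> carrier N"
    and "\<And>f g. f \<in> carrier S \<Longrightarrow> g \<in> carrier S \<Longrightarrow> D (f \<oplus>\<^bsub>S\<^esub> g) = D f \<oplus>\<^bsub>N\<^esub> D g"
    and "\<And>a f. a \<in> carrier A \<Longrightarrow> f \<in> carrier S \<Longrightarrow> D (a \<odot>\<^bsub>S\<^esub> f) = (a \<odot>\<^bsub>S\<^esub> \<one>\<^bsub>S\<^esub>) \<odot>\<^bsub>N\<^esub> D f"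
    and "\<And>f g. f \<in> carrier S \<Longrightarrow> g \<in> carrier S \<Longrightarrow>
           D (f \<otimes>\<^bsub>S\<^esub> g) = f \<odot>\<^bsub>N\<^esub> D g \<oplus>\<^bsub>N\<^esub> g \<odot>\<^bsub>N\<^esub> D f"
  using assms by (auto simp: Der_def)

context
  fixes A :: "('a, 'i) ring_scheme"
    and R :: "('a, 'r, 'j) module_scheme"
    and M :: "('r, 'm, 'k) module_scheme"
    and D :: "'r \<Rightarrow> 'm"
  assumes alg: "algebra A R" and mod: "module R M" and D: "D \<in> Der A R M"
begin

interpretation R: algebra A R by (rule alg)
interpretation M: module R M by (rule mod)

lemma twist_closed: "\<lbrakk>t \<in> carrier M; r \<in> carrier R\<rbrakk> \<Longrightarrow> twist M D t r \<in> carrier M"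
  using DerD(1)[OF D] by (auto simp: twist_def)

lemma twist_add:
  assumes "t \<in> carrier M" "r \<in> carrier R" "s \<in> carrier R"
  shows "twist M D t (r \<oplus>\<^bsub>R\<^esub> s) = twist M D t r \<oplus>\<^bsub>M\<^esub> twist M D t s"
proof -
  have "D r \<in> carrier M" "D s \<in> carrier M" using DerD(1)[OF D] assms by auto
  then show ?thesis
    using assms by (simp add: twist_def DerD(2)[OF D] M.smult_l_distr M.a_ac)
qed

lemma twist_zero: "t \<in> carrier M \<Longrightarrow> twist M D t \<zero>\<^bsub>R\<^esub> = \<zero>\<^bsub>M\<^esub>"
  by (rule additive_zero[OF R.abelian_group_axioms M.abelian_group_axioms])
    (auto intro: twist_closed twist_add)

lemma twist_smult:
  assumes "t \<in> carrier M" "a \<in> carrier A" "r \<in> carrier R"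
  shows "twist M D t (a \<odot>\<^bsub>R\<^esub> r) = (a \<odot>\<^bsub>R\<^esub> \<one>\<^bsub>R\<^esub>) \<odot>\<^bsub>M\<^esub> twist M D t r"
proof -
  have "D r \<in> carrier M" using DerD(1)[OF D] assms by auto
  moreover have "a \<odot>\<^bsub>R\<^esub> r = (a \<odot>\<^bsub>R\<^esub> \<one>\<^bsub>R\<^esub>) \<otimes>\<^bsub>R\<^esub> r"
    using assms by (simp add: R.smult_assoc2)
  then have "(a \<odot>\<^bsub>R\<^esub> r) \<odot>\<^bsub>M\<^esub> t = (a \<odot>\<^bsub>R\<^esub> \<one>\<^bsub>R\<^esub>) \<odot>\<^bsub>M\<^esub> (r \<odot>\<^bsub>M\<^esub> t)"
    using assms by (simp add: M.smult_assoc1)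
  ultimately show ?thesis
    using assms by (simp add: twist_def DerD(3)[OF D] M.smult_r_distr)
qed

lemma twist_mult:
  assumes "t \<in> carrier M" "u \<in> carrier M" "r \<in> carrier R" "s \<in> carrier R"
  shows "twist M D (t \<oplus>\<^bsub>M\<^esub> u) (r \<otimes>\<^bsub>R\<^esub> s) =
    r \<odot>\<^bsub>M\<^esub> twist M D u s \<oplus>\<^bsub>M\<^esub> s \<odot>\<^bsub>M\<^esub> twist M D t r"
proof -
  have c: "D r \<in> carrier M" "D s \<in> carrier M" using DerD(1)[OF D] assms by auto
  have "(r \<otimes>\<^bsub>R\<^esub> s) \<odot>\<^bsub>M\<^esub> t = s \<odot>\<^bsub>M\<^esub> (r \<odot>\<^bsub>M\<^esub> t)"
    using assms by (simp add: M.smult_assoc1[symmetric] R.m_comm)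
  moreover have "(r \<otimes>\<^bsub>R\<^esub> s) \<odot>\<^bsub>M\<^esub> u = r \<odot>\<^bsub>M\<^esub> (s \<odot>\<^bsub>M\<^esub> u)"
    using assms by (simp add: M.smult_assoc1)
  ultimately show ?thesis
    using assms c by (simp add: twist_def DerD(4)[OF D] M.smult_r_distr M.a_ac)
qed

text \<open>The Leibniz rule for convolutions at a point of \<open>G(\<Gamma>)\<close>. Here \<open>\<alpha>'\<close> and \<open>\<beta>'\<close> are the derived
  functions of \<open>\<alpha>\<close> and \<open>\<beta>\<close>, with the same denominators.\<close>

lemma twist_conv:
  assumes "comm_monoid_cancel \<Gamma>" "finite_type_monoid \<Gamma>"
    and \<delta>: "\<delta> \<in> hom (groth_group \<Gamma>) (add_monoid M)"
    and \<alpha>: "has_denom \<Gamma> R d \<alpha>" and \<beta>: "has_denom \<Gamma> R e \<beta>"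
    and \<alpha>': "has_denom \<Gamma> M d \<alpha>'" and \<beta>': "has_denom \<Gamma> M e \<beta>'"
    and \<alpha>'_eq: "\<And>q. q \<in> carrier (groth_group \<Gamma>) \<Longrightarrow> \<alpha>' q = twist M D (\<delta> q) (\<alpha> q)"
    and \<beta>'_eq: "\<And>q. q \<in> carrier (groth_group \<Gamma>) \<Longrightarrow> \<beta>' q = twist M D (\<delta> q) (\<beta> q)"
    and q: "q \<in> carrier (groth_group \<Gamma>)"
  shows "twist M D (\<delta> q) (conv \<Gamma> R (\<lambda>x y. x \<otimes>\<^bsub>R\<^esub> y) \<alpha> \<beta> q) =
    conv \<Gamma> M (\<lambda>x y. x \<odot>\<^bsub>M\<^esub> y) \<alpha> \<beta>' q \<oplus>\<^bsub>M\<^esub> conv \<Gamma> M (\<lambda>x y. x \<odot>\<^bsub>M\<^esub> y) \<beta> \<alpha>' q"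
proof -
  interpret \<Gamma>: comm_monoid_cancel \<Gamma> by fact
  let ?P = "denom_pairs \<Gamma> d e q"
  have fin: "finite ?P"
    using assms(2) has_denom_carrier[OF \<alpha>] has_denom_carrier[OF \<beta>] q by (rule \<Gamma>.finite_denom_pairs')
  have \<delta>c: "\<delta> x \<in> carrier M" if "x \<in> carrier (groth_group \<Gamma>)" for x
    using hom_in_carrier[OF \<delta> that] by simp
  have val: "\<alpha> x \<in> carrier R" "\<beta> x \<in> carrier R" "\<alpha>' x \<in> carrier M" "\<beta>' x \<in> carrier M"
    if "x \<in> carrier (groth_group \<Gamma>)" for x
    using that \<alpha> \<beta> \<alpha>' \<beta>' by (auto intro: has_denom_closed)
  have tw: "twist M D (\<delta> q) (\<alpha> a \<otimes>\<^bsub>R\<^esub> \<beta> b) = \<alpha> a \<odot>\<^bsub>M\<^esub> \<beta>' b \<oplus>\<^bsub>M\<^esub> \<beta> b \<odot>\<^bsub>M\<^esub> \<alpha>' a"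
    if "(a, b) \<in> ?P" for a b
  proof -
    note ab = \<Gamma>.denom_pairsD[OF that]
    have "\<delta> q = \<delta> a \<oplus>\<^bsub>M\<^esub> \<delta> b" using hom_mult[OF \<delta> ab(1,2)] ab(3) by simp
    then show ?thesis using ab(1,2) by (simp add: twist_mult \<delta>c val \<alpha>'_eq \<beta>'_eq)
  qed
  have "twist M D (\<delta> q) (conv \<Gamma> R (\<lambda>x y. x \<otimes>\<^bsub>R\<^esub> y) \<alpha> \<beta> q) =
      twist M D (\<delta> q) (finsum R (\<lambda>(a, b). \<alpha> a \<otimes>\<^bsub>R\<^esub> \<beta> b) ?P)"
    by (subst \<Gamma>.conv_eq_finsum_denom_pairs[OF R.abelian_monoid_axioms assms(2) \<alpha> \<beta> _ _ _ q]) auto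
  also have "\<dots> = finsum M (\<lambda>p. twist M D (\<delta> q) (case p of (a, b) \<Rightarrow> \<alpha> a \<otimes>\<^bsub>R\<^esub> \<beta> b)) ?P"
    by (rule additive_finsum[OF R.abelian_group_axioms M.abelian_group_axioms _ _ fin])
      (auto intro!: twist_closed twist_add \<delta>c q val intro: \<Gamma>.denom_pairsD(1,2))
  also have "\<dots> = finsum M (\<lambda>p. (case p of (a, b) \<Rightarrow> \<alpha> a \<odot>\<^bsub>M\<^esub> \<beta>' b) \<oplus>\<^bsub>M\<^esub>
      (case p of (a, b) \<Rightarrow> \<beta> b \<odot>\<^bsub>M\<^esub> \<alpha>' a)) ?P"
    by (rule M.finsum_cong') (auto simp: tw intro!: M.smult_closed val intro: \<Gamma>.denom_pairsD(1,2))
  also have "\<dots> = finsum M (\<lambda>(a, b). \<alpha> a \<odot>\<^bsub>M\<^esub> \<beta>' b) ?P \<oplus>\<^bsub>M\<^esub>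
      finsum M (\<lambda>(a, b). \<beta> b \<odot>\<^bsub>M\<^esub> \<alpha>' a) ?P"
    by (rule M.finsum_addf) (auto intro!: M.smult_closed val intro: \<Gamma>.denom_pairsD(1,2))
  also have "finsum M (\<lambda>(a, b). \<alpha> a \<odot>\<^bsub>M\<^esub> \<beta>' b) ?P = conv \<Gamma> M (\<lambda>x y. x \<odot>\<^bsub>M\<^esub> y) \<alpha> \<beta>' q"
    by (subst \<Gamma>.conv_eq_finsum_denom_pairs[OF M.abelian_monoid_axioms assms(2) \<alpha> \<beta>' _ _ _ q]) auto
  \<comment> \<open>In the second sum the factors come in the opposite order, so the pairs are swapped.\<close>
  also have "finsum M (\<lambda>(a, b). \<beta> b \<odot>\<^bsub>M\<^esub> \<alpha>' a) ?P =
      finsum M (\<lambda>p. case prod.swap p of (b, a) \<Rightarrow> \<beta> b \<odot>\<^bsub>M\<^esub> \<alpha>' a) ?P"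
    by (rule M.finsum_cong') (auto intro!: M.smult_closed val intro: \<Gamma>.denom_pairsD(1,2))
  also have "\<dots> = finsum M (\<lambda>(b, a). \<beta> b \<odot>\<^bsub>M\<^esub> \<alpha>' a) (denom_pairs \<Gamma> e d q)"
    unfolding \<Gamma>.denom_pairs_swap[of e d q]
    by (rule M.finsum_reindex[symmetric])
      (auto intro!: M.smult_closed val intro: \<Gamma>.denom_pairsD(1,2))
  also have "\<dots> = conv \<Gamma> M (\<lambda>x y. x \<odot>\<^bsub>M\<^esub> y) \<beta> \<alpha>' q"
    by (subst \<Gamma>.conv_eq_finsum_denom_pairs[OF M.abelian_monoid_axioms assms(2) \<beta> \<alpha>' _ _ _ q]) auto
  finally show ?thesis .
qed

end


section \<open>The derivation on functions with a common denominator\<close>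

theorem proposition3p4:
  fixes A :: "('a, 'i) ring_scheme"
    and R :: "('a, 'r, 'j) module_scheme"
    and M :: "('r, 'm, 'k) module_scheme"
    and \<Gamma> :: "('g, 'l) monoid_scheme"
    and D :: "'r \<Rightarrow> 'm"
    and \<delta> :: "('g \<times> 'g) set \<Rightarrow> 'm"
  assumes "cring A"
    and "algebra A R"
    and "module R M"
    and "comm_monoid_cancel \<Gamma>"
    and "finite_type_monoid \<Gamma>"
    and "D \<in> Der A R M"
    and "\<delta> \<in> hom (groth_group \<Gamma>) (add_monoid M)"
  shows "(\<lambda>\<alpha>\<in>fin_denom_funs \<Gamma> R. \<lambda>q\<in>carrier (groth_group \<Gamma>). D (\<alpha> q) \<oplus>\<^bsub>M\<^esub> \<alpha> q \<odot>\<^bsub>M\<^esub> \<delta> q)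
           \<in> Der A (fin_denom_algebra \<Gamma> R) (fin_denom_module \<Gamma> M)"
proof -
  interpret R: algebra A R by fact
  interpret M: module R M by fact
  interpret \<Gamma>: comm_monoid_cancel \<Gamma> by fact
  interpret Q: comm_group "groth_group \<Gamma>" by (rule \<Gamma>.groth_comm_group)
  note tw = assms(2,3,6)
  let ?G = "carrier (groth_group \<Gamma>)"
  define E where "E \<alpha> = (\<lambda>q\<in>?G. twist M D (\<delta> q) (\<alpha> q))" for \<alpha>
  have \<delta>c: "\<delta> q \<in> carrier M" if "q \<in> ?G" for q
    using hom_in_carrier[OF assms(7) that] by simp
  have E_denom: "has_denom \<Gamma> M d (E \<alpha>)" if "has_denom \<Gamma> R d \<alpha>" for d \<alpha>
    unfolding E_def using that
    by (rule has_denom_pointwise)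
      (auto intro: twist_closed[OF tw] has_denom_closed[OF that] \<delta>c simp: twist_zero[OF tw \<delta>c])
  have add: "E (\<lambda>q\<in>?G. \<alpha> q \<oplus>\<^bsub>R\<^esub> \<beta> q) = (\<lambda>q\<in>?G. E \<alpha> q \<oplus>\<^bsub>M\<^esub> E \<beta> q)"
    and add_mem: "(\<lambda>q\<in>?G. \<alpha> q \<oplus>\<^bsub>R\<^esub> \<beta> q) \<in> fin_denom_funs \<Gamma> R"
    if "\<alpha> \<in> fin_denom_funs \<Gamma> R" "\<beta> \<in> fin_denom_funs \<Gamma> R" for \<alpha> \<beta>
  proof -
    obtain d e where de: "has_denom \<Gamma> R d \<alpha>" "has_denom \<Gamma> R e \<beta>"
      using \<open>\<alpha> \<in> _\<close> \<open>\<beta> \<in> _\<close> by (auto simp: fin_denom_funs_iff)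
    have val: "\<alpha> q \<in> carrier R" "\<beta> q \<in> carrier R" if "q \<in> ?G" for q
      using that de by (auto intro: has_denom_closed)
    show "E (\<lambda>q\<in>?G. \<alpha> q \<oplus>\<^bsub>R\<^esub> \<beta> q) = (\<lambda>q\<in>?G. E \<alpha> q \<oplus>\<^bsub>M\<^esub> E \<beta> q)"
      by (rule ext) (simp add: E_def twist_add[OF tw] \<delta>c val)
    \<comment> \<open>The product \<open>de\<close> is a common denominator, hence also one of the sum.\<close>
    have "has_denom \<Gamma> R (d \<otimes>\<^bsub>\<Gamma>\<^esub> e) \<alpha>" "has_denom \<Gamma> R (d \<otimes>\<^bsub>\<Gamma>\<^esub> e) \<beta>"
      using de by (auto intro: \<Gamma>.has_denom_mult_right \<Gamma>.has_denom_mult_left has_denom_carrier)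
    then have "has_denom \<Gamma> R (d \<otimes>\<^bsub>\<Gamma>\<^esub> e) (\<lambda>q\<in>?G. \<alpha> q \<oplus>\<^bsub>R\<^esub> \<beta> q)"
      unfolding has_denom_def by (auto simp: val)
    then show "(\<lambda>q\<in>?G. \<alpha> q \<oplus>\<^bsub>R\<^esub> \<beta> q) \<in> fin_denom_funs \<Gamma> R"
      by (auto simp: fin_denom_funs_iff)
  qed
  have smult_mem: "(\<lambda>q\<in>?G. a \<odot>\<^bsub>R\<^esub> \<alpha> q) \<in> fin_denom_funs \<Gamma> R"
    if "a \<in> carrier A" "\<alpha> \<in> fin_denom_funs \<Gamma> R" for a \<alpha>
  proof -
    obtain d where d: "has_denom \<Gamma> R d \<alpha>" using \<open>\<alpha> \<in> _\<close> by (auto simp: fin_denom_funs_iff)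
    have "has_denom \<Gamma> R d (\<lambda>q\<in>?G. a \<odot>\<^bsub>R\<^esub> \<alpha> q)"
      using d by (rule has_denom_pointwise) (use \<open>a \<in> carrier A\<close> d in \<open>auto intro: has_denom_closed\<close>)
    then show ?thesis by (auto simp: fin_denom_funs_iff)
  qed
  have smult: "E (\<lambda>q\<in>?G. a \<odot>\<^bsub>R\<^esub> \<alpha> q) = conv \<Gamma> M (\<lambda>x y. x \<odot>\<^bsub>M\<^esub> y)
      (\<lambda>q\<in>?G. a \<odot>\<^bsub>R\<^esub> (\<lambda>q\<in>?G. if q = \<one>\<^bsub>groth_group \<Gamma>\<^esub> then \<one>\<^bsub>R\<^esub> else \<zero>\<^bsub>R\<^esub>) q) (E \<alpha>)"
    if "a \<in> carrier A" "\<alpha> \<in> fin_denom_funs \<Gamma> R" for a \<alpha>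
  proof
    fix q
    obtain d where d: "has_denom \<Gamma> R d \<alpha>" using \<open>\<alpha> \<in> _\<close> by (auto simp: fin_denom_funs_iff)
    note val = has_denom_closed[OF d] has_denom_closed[OF E_denom[OF d]]
    show "E (\<lambda>q\<in>?G. a \<odot>\<^bsub>R\<^esub> \<alpha> q) q = conv \<Gamma> M (\<lambda>x y. x \<odot>\<^bsub>M\<^esub> y)
      (\<lambda>q\<in>?G. a \<odot>\<^bsub>R\<^esub> (\<lambda>q\<in>?G. if q = \<one>\<^bsub>groth_group \<Gamma>\<^esub> then \<one>\<^bsub>R\<^esub> else \<zero>\<^bsub>R\<^esub>) q) (E \<alpha>) q"
    proof (cases "q \<in> ?G")
      case True
      have "E (\<lambda>q\<in>?G. a \<odot>\<^bsub>R\<^esub> \<alpha> q) q = (a \<odot>\<^bsub>R\<^esub> \<one>\<^bsub>R\<^esub>) \<odot>\<^bsub>M\<^esub> E \<alpha> q"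
        using True that by (simp add: E_def twist_smult[OF tw] \<delta>c val)
      then show ?thesis
        using True that val
        by (subst \<Gamma>.conv_at_one[where K = M and z = "\<zero>\<^bsub>R\<^esub>" and c = "a \<odot>\<^bsub>R\<^esub> \<one>\<^bsub>R\<^esub>",
              OF M.abelian_monoid_axioms]) simp_all
    qed (simp add: E_def conv_def)
  qed
  have mult: "E (conv \<Gamma> R (\<lambda>x y. x \<otimes>\<^bsub>R\<^esub> y) \<alpha> \<beta>) =
      (\<lambda>q\<in>?G. conv \<Gamma> M (\<lambda>x y. x \<odot>\<^bsub>M\<^esub> y) \<alpha> (E \<beta>) q \<oplus>\<^bsub>M\<^esub> conv \<Gamma> M (\<lambda>x y. x \<odot>\<^bsub>M\<^esub> y) \<beta> (E \<alpha>) q)"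
    and mult_mem: "conv \<Gamma> R (\<lambda>x y. x \<otimes>\<^bsub>R\<^esub> y) \<alpha> \<beta> \<in> fin_denom_funs \<Gamma> R"
    if "\<alpha> \<in> fin_denom_funs \<Gamma> R" "\<beta> \<in> fin_denom_funs \<Gamma> R" for \<alpha> \<beta>
  proof -
    obtain d e where de: "has_denom \<Gamma> R d \<alpha>" "has_denom \<Gamma> R e \<beta>"
      using \<open>\<alpha> \<in> _\<close> \<open>\<beta> \<in> _\<close> by (auto simp: fin_denom_funs_iff)
    show "E (conv \<Gamma> R (\<lambda>x y. x \<otimes>\<^bsub>R\<^esub> y) \<alpha> \<beta>) =
      (\<lambda>q\<in>?G. conv \<Gamma> M (\<lambda>x y. x \<odot>\<^bsub>M\<^esub> y) \<alpha> (E \<beta>) q \<oplus>\<^bsub>M\<^esub> conv \<Gamma> M (\<lambda>x y. x \<odot>\<^bsub>M\<^esub> y) \<beta> (E \<alpha>) q)"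
      unfolding E_def[of "conv \<Gamma> R (\<lambda>x y. x \<otimes>\<^bsub>R\<^esub> y) \<alpha> \<beta>"]
      by (rule restrict_ext)
        (rule twist_conv[OF tw assms(4,5,7) de E_denom[OF de(1)] E_denom[OF de(2)]],
          simp_all add: E_def)
    have "has_denom \<Gamma> R (d \<otimes>\<^bsub>\<Gamma>\<^esub> e) (conv \<Gamma> R (\<lambda>x y. x \<otimes>\<^bsub>R\<^esub> y) \<alpha> \<beta>)"
      by (rule \<Gamma>.has_denom_conv[OF R.abelian_monoid_axioms assms(5) de]) auto
    then show "conv \<Gamma> R (\<lambda>x y. x \<otimes>\<^bsub>R\<^esub> y) \<alpha> \<beta> \<in> fin_denom_funs \<Gamma> R"
      by (auto simp: fin_denom_funs_iff)
  qed
  have E_mem: "E \<alpha> \<in> fin_denom_funs \<Gamma> M" if "\<alpha> \<in> fin_denom_funs \<Gamma> R" for \<alpha>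
    using that E_denom by (auto simp: fin_denom_funs_iff)
  have "(\<lambda>\<alpha>\<in>fin_denom_funs \<Gamma> R. E \<alpha>) \<in> Der A (fin_denom_algebra \<Gamma> R) (fin_denom_module \<Gamma> M)"
    unfolding Der_def fin_denom_algebra_def fin_denom_module_def
    by (simp add: add add_mem smult smult_mem mult mult_mem E_mem)
  then show ?thesis by (simp add: E_def twist_def)
qed

end
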